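(* Consider the semi-explicit differential-algebraic system $\dot x_d = f_d(x)+g_d(x)u$, $0=\phi(x)$, $x=(x_d,x_a)$, with differentiation index $\nu=1$, where $\phi$ does not depend on $u$ and where $J_{ext}(x)=\begin{bmatrix} J_a(x) & J_d(x)g_d(x)\end{bmatrix}$ has full row rank for all $x\in\mathcal C\cap\mathcal M$. Let $\alpha_0$ be a class-$\mathcal K_\infty$ function. Suppose that $b$ is a control barrier function with $\mathcal D=\{x: b(x)\ge 0\}\subseteq\mathcal C$, such that $b(x(0))\ge 0$ and $x(0)\in\mathcal D\cap\mathcal M$. Then the set $\mathcal D\cap\mathcal M$ is positively invariant if the input $u(t)$ satisfies, for all $x\in\mathcal D\cap\mathcal M$, $$P(x)\big(J_d(x)f_d(x)+J_d(x)g_d(x)u\big)=0,$$ $$\mathcal L_{\hat f}b(x)+\mathcal L_{\hat g}b(x)\,u\ \ge\ -\alpha_0(b(x)).$$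
   Context: System: $x_d(t)\in\mathbb R^{n_d}$ (dynamic states), $x_a(t)\in\mathbb R^{n_a}$ (algebraic states), $x=(x_d,x_a)\in\mathbb R^{n_x}$, $n_x=n_d+n_a$, input $u(t)\in\mathbb R^{n_u}$. The maps $f_d:\mathbb R^{n_x}\to\mathbb R^{n_d}$, $g_d:\mathbb R^{n_x}\to\mathbb R^{n_d\times n_u}$, $\phi:\mathbb R^{n_x}\to\mathbb R^{n_m}$ are smooth. The constraint manifold is $\mathcal M=\{x:\phi(x)=0\}$. The safe set is $\mathcal C=\{x: h(x)\ge 0\}$ (closed) for a given function $h$. Jacobians: $J_d(x)=\partial\phi/\partial x_d\in\mathbb R^{n_m\times n_d}$, $J_a(x)=\partial\phi/\partial x_a\in\mathbb R^{n_m\times n_a}$. $M^\dagger$ denotes the Moore-Penrose pseudoinverse. $P(x)=I_{n_m}-J_a(x)J_a(x)^\dagger$. Differentiation index: the number of time differentiations of the algebraic constraint needed to obtain an ODE using algebraic manipulations. For index 1, $J_a(x)$ has full row rank on $\mathcal C\cap\mathcal M$, so that a single differentiation of $\phi(x(t))=0$ allows one to solve for $\dot x_a$. The constrained dynamics on $\mathcal M$ are taken with $\dot x_a=-J_a(x)^\dagger J_d(x)(f_d(x)+g_d(x)u)$, i.e. $\dot x=\hat f(x)+\hat g(x)u$ with projected vector fields $$\hat f=\begin{bmatrix} f_d\\ -J_a^\dagger J_d f_d\end{bmatrix},\qquad \hat g=\begin{bmatrix} g_d\\ -J_a^\dagger J_d g_d\end{bmatrix}.$$ These dynamics are regarded as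 well defined and locally Lipschitz on $\mathcal C\cap\mathcal M$. Lie derivatives: $\mathcal L_{\hat f}b=\nabla b^\top\hat f$, $\mathcal L_{\hat g}b=\nabla b^\top\hat g$. A control barrier function (CBF) is a continuously differentiable $b:\mathbb R^{n_x}\to\mathbb R$ with $\mathcal D=\{x:b(x)\ge0\}\subseteq\mathcal C$. A class-$\mathcal K_\infty$ function here is a strictly increasing $\alpha:\mathbb R\to\mathbb R$ with $\alpha(0)=0$. A set $S$ is positively invariant under a control policy $\mu$ if $x(0)\in S$ and $u(t)=\mu(x(t))$ for all $t\ge0$ imply $x(t)\in S$ for all $t\ge 0$.
   Formalization: Added, as the claim fails otherwise: at points of M with b=0, the derivative of b is nonzero on the kernel of [J_d J_a] (fails: x_d'=1, 0=x_a, b=-(max(x_d,0))^2); and the closed loop is Lipschitz on a neighbourhood in M of each point of C∩M, not only relative to C∩M. *)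

theory Defs
  imports "HOL-Analysis.Analysis"
begin

section \<open>Regularity of functions\<close>

text \<open>A function is \<open>C\<^sup>k\<close> on the whole space; for \<open>k + 1\<close>, it is differentiable and all its
  directional derivatives are \<open>C\<^sup>k\<close>. In finite dimension this is the usual notion.\<close>

primrec Ck :: "nat \<Rightarrow> ('a::euclidean_space \<Rightarrow> 'b::euclidean_space) \<Rightarrow> bool" where
  "Ck 0 f \<longleftrightarrow> continuous_on UNIV f"
| "Ck (Suc k) f \<longleftrightarrow>
     (\<forall>x. f differentiable (at x)) \<and> (\<forall>v. Ck k (\<lambda>x. frechet_derivative f (at x) v))"

definition smooth :: "('a::euclidean_space \<Rightarrow> 'b::euclidean_space) \<Rightarrow> bool" where
  "smooth f \<longleftrightarrow> (\<forall>k. Ck k f)"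

definition grad :: "('a::euclidean_space \<Rightarrow> real) \<Rightarrow> 'a \<Rightarrow> 'a" where
  "grad b x = (\<Sum>i\<in>Basis. frechet_derivative b (at x) i *\<^sub>R i)"

section \<open>Matrices\<close>

definition is_pinv :: "real^'n^'m \<Rightarrow> real^'m^'n \<Rightarrow> bool" where
  "is_pinv A B \<longleftrightarrow> A ** B ** A = A \<and> B ** A ** B = B \<and>
     transpose (A ** B) = A ** B \<and> transpose (B ** A) = B ** A"

text \<open>The four Penrose equations have exactly one solution for every real matrix.\<close>

definition pinv :: "real^'n^'m \<Rightarrow> real^'m^'n" where
  "pinv A = (THE B. is_pinv A B)"

definition full_row_rank :: "real^'n^'m \<Rightarrow> bool" where
  "full_row_rank (A :: real^'n^'m) \<longleftrightarrow> rank A = CARD('m)"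

definition hblock :: "real^'n^'m \<Rightarrow> real^'k^'m \<Rightarrow> real^('n + 'k)^'m" where
  "hblock A B = (\<chi> i j. case j of Inl k \<Rightarrow> A $ i $ k | Inr l \<Rightarrow> B $ i $ l)"

section \<open>The semi-explicit system\<close>

text \<open>A state is a pair of dynamic and algebraic states. An input matrix with \<open>n\<^sub>d + n\<^sub>a\<close> rows
  is correspondingly a pair (upper block, lower block).\<close>

type_synonym ('d, 'a) state = "(real^'d) \<times> (real^'a)"

definition constraint_manifold :: "(('d::finite, 'a::finite) state \<Rightarrow> real^'m) \<Rightarrow> ('d, 'a) state set"
  where "constraint_manifold \<phi> = {x. \<phi> x = 0}"

definition superlevel :: "('x \<Rightarrow> real) \<Rightarrow> 'x set" where
  "superlevel h = {x. h x \<ge> 0}"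

definition Jd :: "(('d::finite, 'a::finite) state \<Rightarrow> real^'m) \<Rightarrow> ('d, 'a) state \<Rightarrow> real^'d^'m" where
  "Jd \<phi> x = jacobian (\<lambda>y. \<phi> (y, snd x)) (at (fst x))"

definition Ja :: "(('d::finite, 'a::finite) state \<Rightarrow> real^'m) \<Rightarrow> ('d, 'a) state \<Rightarrow> real^'a^'m" where
  "Ja \<phi> x = jacobian (\<lambda>y. \<phi> (fst x, y)) (at (snd x))"

definition Proj :: "(('d::finite, 'a::finite) state \<Rightarrow> real^'m) \<Rightarrow> ('d, 'a) state \<Rightarrow> real^'m^'m" where
  "Proj \<phi> x = mat 1 - Ja \<phi> x ** pinv (Ja \<phi> x)"

definition Jext :: "(('d::finite, 'a::finite) state \<Rightarrow> real^'m) \<Rightarrow> (('d, 'a) state \<Rightarrow> real^'u^'d)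
    \<Rightarrow> ('d, 'a) state \<Rightarrow> real^('a + 'u)^'m" where
  "Jext \<phi> gd x = hblock (Ja \<phi> x) (Jd \<phi> x ** gd x)"

text \<open>Index one: a single differentiation of the constraint gives
  \<open>J\<^sub>a x\<^sub>a' = - J\<^sub>d (f\<^sub>d + g\<^sub>d u)\<close>, which can be solved for \<open>x\<^sub>a'\<close>
  because \<open>J\<^sub>a\<close> has full row rank. (Zero differentiations never suffice, since \<open>x\<^sub>a'\<close> does not
  occur in the system and both \<open>'a\<close> and \<open>'m\<close> are nonempty.)\<close>

definition index_one :: "(('d::finite, 'a::finite) state \<Rightarrow> real^'m) \<Rightarrow> ('d, 'a) state set \<Rightarrow> bool" where
  "index_one \<phi> C \<longleftrightarrow> (\<forall>x \<in> C \<inter> constraint_manifold \<phi>. full_row_rank (Ja \<phi> x))"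

definition fhat :: "(('d::finite, 'a::finite) state \<Rightarrow> real^'m) \<Rightarrow> (('d, 'a) state \<Rightarrow> real^'d)
    \<Rightarrow> ('d, 'a) state \<Rightarrow> ('d, 'a) state" where
  "fhat \<phi> fd x = (fd x, - ((pinv (Ja \<phi> x) ** Jd \<phi> x) *v fd x))"

definition ghat :: "(('d::finite, 'a::finite) state \<Rightarrow> real^'m) \<Rightarrow> (('d, 'a) state \<Rightarrow> real^'u^'d)
    \<Rightarrow> ('d, 'a) state \<Rightarrow> (real^'u^'d) \<times> (real^'u^'a)" where
  "ghat \<phi> gd x = (gd x, - (pinv (Ja \<phi> x) ** Jd \<phi> x ** gd x))"

definition block_mv :: "(real^'u^'d) \<times> (real^'u^'a) \<Rightarrow> real^'u \<Rightarrow> ('d::finite, 'a::finite) state" where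
  "block_mv G u = (fst G *v u, snd G *v u)"

definition closed_loop :: "(('d::finite, 'a::finite) state \<Rightarrow> real^'m) \<Rightarrow> (('d, 'a) state \<Rightarrow> real^'d)
    \<Rightarrow> (('d, 'a) state \<Rightarrow> real^'u^'d) \<Rightarrow> (('d, 'a) state \<Rightarrow> real^'u)
    \<Rightarrow> ('d, 'a) state \<Rightarrow> ('d, 'a) state" where
  "closed_loop \<phi> fd gd \<mu> x = fhat \<phi> fd x + block_mv (ghat \<phi> gd x) (\<mu> x)"

text \<open>Lie derivatives; for an input matrix the result is the row vector \<open>\<nabla>b\<^sup>T G\<close>.\<close>

definition lie_f :: "(('d::finite, 'a::finite) state \<Rightarrow> ('d, 'a) state) \<Rightarrow> (('d, 'a) state \<Rightarrow> real)
    \<Rightarrow> ('d, 'a) state \<Rightarrow> real" where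
  "lie_f f b x = grad b x \<bullet> f x"

definition lie_g :: "(('d::finite, 'a::finite) state \<Rightarrow> (real^'u^'d) \<times> (real^'u^'a))
    \<Rightarrow> (('d, 'a) state \<Rightarrow> real) \<Rightarrow> ('d, 'a) state \<Rightarrow> real^'u" where
  "lie_g g b x = fst (grad b x) v* fst (g x) + snd (grad b x) v* snd (g x)"

section \<open>Barrier functions and invariance\<close>

definition class_Kinf :: "(real \<Rightarrow> real) \<Rightarrow> bool" where
  "class_Kinf \<alpha> \<longleftrightarrow> strict_mono \<alpha> \<and> \<alpha> 0 = 0"

definition is_CBF :: "('x::euclidean_space \<Rightarrow> real) \<Rightarrow> ('x \<Rightarrow> real) \<Rightarrow> bool" where
  "is_CBF h b \<longleftrightarrow> Ck 1 b \<and> superlevel b \<subseteq> superlevel h"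

text \<open>Solutions live on an arbitrary time interval starting at 0. The interval \<open>{0..}\<close> is the case
  of global solutions; bounded intervals also cover solutions with finite escape time.\<close>

definition solution_on :: "('x::real_normed_vector \<Rightarrow> 'x) \<Rightarrow> real set \<Rightarrow> (real \<Rightarrow> 'x) \<Rightarrow> bool" where
  "solution_on F I x \<longleftrightarrow> (\<forall>t\<in>I. (x has_vector_derivative F (x t)) (at t within I))"

definition positively_invariant :: "('x::real_normed_vector \<Rightarrow> 'x) \<Rightarrow> 'x set \<Rightarrow> bool" where
  "positively_invariant F S \<longleftrightarrow>
     (\<forall>I x. is_interval I \<longrightarrow> 0 \<in> I \<longrightarrow> I \<subseteq> {0..} \<longrightarrow> solution_on F I x \<longrightarrow> x 0 \<in> S
        \<longrightarrow> (\<forall>t\<in>I. x t \<in> S))"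

text \<open>\<open>F\<close> as a vector field along the manifold \<open>M\<close>: every point of \<open>S\<close> has a neighbourhood in \<open>M\<close>
  (not merely in \<open>S\<close>) on which \<open>F\<close> is Lipschitz.\<close>

definition locally_Lipschitz_along ::
    "'x::metric_space set \<Rightarrow> ('x \<Rightarrow> 'y::metric_space) \<Rightarrow> 'x set \<Rightarrow> bool" where
  "locally_Lipschitz_along M F S \<longleftrightarrow>
     (\<forall>x\<in>S. \<exists>\<epsilon>>0. \<exists>L. L-lipschitz_on (ball x \<epsilon> \<inter> M) F)"

text \<open>0 is a regular value of the restriction of \<open>b\<close> to the constraint manifold: where \<open>b\<close> vanishes,
  its derivative is nonzero on the kernel of \<open>[J\<^sub>d J\<^sub>a]\<close>, i.e. on the tangent space of the manifold.
  Without such a condition the barrier inequality on the superlevel set alone does not give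
  invariance: for \<open>x\<^sub>d' = 1\<close>, \<open>0 = x\<^sub>a\<close> and \<open>b x = - (max x\<^sub>d 0)\<^sup>2\<close>, the inequality holds at every
  point of \<open>{b \<ge> 0}\<close> (there \<open>b\<close> and its gradient vanish), but solutions leave that set.\<close>

definition regular_boundary :: "(('d::finite, 'a::finite) state \<Rightarrow> real^'m)
    \<Rightarrow> (('d, 'a) state \<Rightarrow> real) \<Rightarrow> bool" where
  "regular_boundary \<phi> b \<longleftrightarrow> (\<forall>x \<in> constraint_manifold \<phi>. b x = 0 \<longrightarrow>
     (\<exists>v. Jd \<phi> x *v fst v + Ja \<phi> x *v snd v = 0 \<and> grad b x \<bullet> v \<noteq> 0))"

end

theory Submission
  imports Defs
begin

text \<open>Near a point of \<open>\<D> \<inter> \<M>\<close> the matrix \<open>J\<^sub>a\<close> has full row rank, so \<open>J\<^sub>a J\<^sub>a\<^sup>\<dagger> = I\<close>, the closed loop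
  is tangent to the level sets of \<open>\<phi>\<close>, and a solution cannot leave \<open>\<M>\<close> there. Within \<open>\<M>\<close>, the
  barrier inequality at \<open>b = 0\<close> and the regularity of the boundary make the closed loop
  subtangential to \<open>\<D> \<inter> \<M>\<close>. As \<open>b\<close> is only \<open>C\<^sup>1\<close>, \<open>b\<close> along a solution satisfies no Gronwall
  inequality outside \<open>\<D>\<close>; the distance to \<open>\<D> \<inter> \<M>\<close> does, by the local Lipschitz condition.\<close>

section \<open>Induction along a real interval\<close>

text \<open>If \<open>P\<close> failed at \<open>t\<close>, compactness would give a last point
  before \<open>t\<close> where it holds, and \<open>step\<close> would push beyond it. Used both
  for the comparison bound on the distance and for gluing local invariance along a
  trajectory.\<close>

lemma right_extension_interval:
  fixes a b :: real
  assumes clo: "closed {t \<in> {a..b}. P t}" and "P a"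
    and step: "\<And>t. a \<le> t \<Longrightarrow> t < b \<Longrightarrow> P t \<Longrightarrow> \<exists>\<delta>>0. \<forall>s. t < s \<and> s < t + \<delta> \<and> s \<le> b \<longrightarrow> P s"
    and t: "t \<in> {a..b}"
  shows "P t"
proof (rule ccontr)
  assume nP: "\<not> P t"
  define K where "K = {s \<in> {a..b}. P s} \<inter> {a..t}"
  have "compact K"
    unfolding K_def using clo by (intro closed_Int_compact) auto
  moreover have "K \<noteq> {}"
    using \<open>P a\<close> t by (auto simp: K_def)
  ultimately obtain c where c: "c \<in> K" and cmax: "\<And>s. s \<in> K \<Longrightarrow> s \<le> c"
    by (meson compact_attains_sup)
  have "c < t" using c nP by (auto simp: K_def order_less_le)
  then obtain \<delta> where \<delta>: "\<delta> > 0" "\<And>s. c < s \<Longrightarrow> s < c + \<delta> \<Longrightarrow> s \<le> b \<Longrightarrow> P s"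
    using step[of c] c t by (auto simp: K_def)
  obtain s where s: "c < s" "s < min (c + \<delta>) t"
    using dense[of c "min (c + \<delta>) t"] \<delta>(1) \<open>c < t\<close> by auto
  then have "s \<in> K" using \<delta>(2)[of s] c t by (auto simp: K_def)
  with cmax s show False by fastforce
qed

section \<open>Subtangential directions of constrained sets\<close>

text \<open>Lyusternik's theorem, via Brouwer: the correction of \<open>z + h w\<close> along the right inverse
  \<open>R\<close> is a fixed point of \<open>c \<mapsto> c - \<phi> (z + h w + R c)\<close> on a ball of radius \<open>O(\<eta> h)\<close>.\<close>

lemma zero_set_subtangential:
  fixes \<phi> :: "'x::euclidean_space \<Rightarrow> 'y::euclidean_space"
  assumes cont: "continuous_on UNIV \<phi>" and der: "(\<phi> has_derivative D) (at z)" and z: "\<phi> z = 0"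
    and R: "linear R" "\<And>c. D (R c) = c" and w: "D w = 0" and "\<eta> > 0"
  shows "\<exists>\<delta>>0. \<forall>h. 0 < h \<and> h < \<delta> \<longrightarrow> (\<exists>p. \<phi> p = 0 \<and> norm (p - (z + h *\<^sub>R w)) \<le> \<eta> * h)"
proof -
  have D: "linear D" using der has_derivative_linear by blast
  obtain K where K: "K > 0" "\<And>c. norm (R c) \<le> K * norm c"
    using linear_bounded_pos[OF R(1)] by auto
  \<comment> \<open>On the Brouwer ball of radius \<open>\<rho> * h\<close>, \<open>R\<close>
    produces corrections of norm at most \<open>\<eta> * h\<close>. The accuracy \<open>e\<close>
    keeps the linearization error at displacements up to \<open>h * (norm w + \<eta>)\<close> within
    \<open>\<rho> * h\<close>.\<close>
  define \<rho> where "\<rho> = \<eta> / K"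
  define e where "e = \<rho> / (norm w + \<eta>)"
  have pos: "\<rho> > 0" "norm w + \<eta> > 0" using \<open>\<eta> > 0\<close> K(1) by (auto simp: \<rho>_def add_nonneg_pos)
  then have "e > 0" by (simp add: e_def)
  then obtain d where d: "d > 0"
    and dd: "\<And>y. norm (y - z) < d \<Longrightarrow> norm (\<phi> y - \<phi> z - D (y - z)) \<le> e * norm (y - z)"
    using der unfolding has_derivative_at_alt by blast
  show ?thesis
  proof (intro exI[of _ "d / (norm w + \<eta>)"] conjI allI impI)
    show "d / (norm w + \<eta>) > 0" using d pos by simp
    fix h assume h: "0 < h \<and> h < d / (norm w + \<eta>)"
    define T where "T = (\<lambda>c. c - \<phi> (z + (h *\<^sub>R w + R c)))"
    have Rb: "norm (R c) \<le> \<eta> * h" if "norm c \<le> \<rho> * h" for c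
    proof -
      have "norm (R c) \<le> K * (\<rho> * h)"
        using K(2)[of c] that K(1) by (smt (verit) mult_left_mono)
      then show ?thesis using K(1) by (simp add: \<rho>_def)
    qed
    have T: "T c \<in> cball 0 (\<rho> * h)" if "c \<in> cball 0 (\<rho> * h)" for c
    proof -
      define k where "k = h *\<^sub>R w + R c"
      have "norm k \<le> h * norm w + \<eta> * h"
        unfolding k_def using norm_triangle_ineq[of "h *\<^sub>R w" "R c"] Rb[of c] that h by simp
      then have k: "norm k \<le> h * (norm w + \<eta>)" by (simp add: algebra_simps)
      also have "\<dots> < d" using h pos by (simp add: field_simps)
      finally have kd: "norm k < d" .
      \<comment> \<open>With \<open>\<phi> z = 0\<close> this makes \<open>T c\<close> minus the
        linearization error of \<open>\<phi>\<close> at the displacement \<open>k\<close>.\<close>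
      have "D k = c"
        unfolding k_def using D R(2) w by (simp add: linear_add linear_scale)
      then have "norm (T c) \<le> e * norm k"
        using dd[of "z + k"] kd z by (simp add: T_def k_def norm_minus_commute)
      also have "\<dots> \<le> e * (h * (norm w + \<eta>))" using k \<open>e > 0\<close> by simp
      also have "\<dots> = \<rho> * h" using pos by (simp add: e_def)
      finally show ?thesis by simp
    qed
    have "continuous_on (cball 0 (\<rho> * h)) R"
      using R(1) by (simp add: linear_continuous_on linear_conv_bounded_linear)
    then have "continuous_on (cball 0 (\<rho> * h)) T"
      unfolding T_def
      by (intro continuous_on_diff continuous_on_id continuous_on_compose2[OF cont]
          continuous_on_add continuous_on_const) auto
    moreover have "\<rho> * h > 0" using pos h by simp
    ultimately obtain c where c: "c \<in> cball 0 (\<rho> * h)" "T c = c"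
      using brouwer_ball[of "\<rho> * h" 0 T] T by blast
    show "\<exists>p. \<phi> p = 0 \<and> norm (p - (z + h *\<^sub>R w)) \<le> \<eta> * h"
    proof (intro exI conjI)
      have "X = 0" if "c - X = c" for X using that by simp
      then show "\<phi> (z + (h *\<^sub>R w + R c)) = 0" using c(2) unfolding T_def .
      have "norm (R c) \<le> \<eta> * h" using c(1) by (intro Rb) simp
      then show "norm (z + (h *\<^sub>R w + R c) - (z + h *\<^sub>R w)) \<le> \<eta> * h"
        by (simp add: add.assoc[symmetric])
    qed
  qed
qed

text \<open>Where \<open>b z > 0\<close>, continuity suffices. Where \<open>b z = 0\<close>,
  \<open>w\<close> may be tangent to the level set of \<open>b\<close>, so it is tilted slightly
  towards a direction in the kernel of \<open>D\<close> along which \<open>b\<close> increases; the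
  linear growth of \<open>b\<close> then dominates all errors.\<close>

lemma constrained_superlevel_subtangential:
  fixes \<phi> :: "'x::euclidean_space \<Rightarrow> 'y::euclidean_space" and b :: "'x \<Rightarrow> real"
  assumes cont: "continuous_on UNIV \<phi>" and der: "(\<phi> has_derivative D) (at z)" and z: "\<phi> z = 0"
    and R: "linear R" "\<And>c. D (R c) = c" and w: "D w = 0"
    and b: "(b has_derivative b') (at z)" "b z \<ge> 0"
    and inward: "b z = 0 \<Longrightarrow> b' w \<ge> 0"
    and transversal: "b z = 0 \<Longrightarrow> \<exists>v. D v = 0 \<and> b' v \<noteq> 0" and "\<eta> > 0"
  shows "\<exists>\<delta>>0. \<forall>h. 0 < h \<and> h < \<delta> \<longrightarrow>
    (\<exists>p. \<phi> p = 0 \<and> b p \<ge> 0 \<and> norm (p - (z + h *\<^sub>R w)) \<le> \<eta> * h)"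
proof (cases "b z = 0")
  case False
  with b have bz: "b z > 0" by simp
  have "continuous (at z) b" using b(1) has_derivative_continuous by blast
  then obtain d where d: "d > 0" "\<And>y. dist y z < d \<Longrightarrow> dist (b y) (b z) < b z"
    using bz unfolding continuous_at_eps_delta by blast
  obtain \<delta> where \<delta>: "\<delta> > 0"
    "\<And>h. 0 < h \<Longrightarrow> h < \<delta> \<Longrightarrow> \<exists>p. \<phi> p = 0 \<and> norm (p - (z + h *\<^sub>R w)) \<le> \<eta> * h"
    using zero_set_subtangential[OF cont der z R w \<open>\<eta> > 0\<close>] by blast
  have pos: "norm w + \<eta> > 0" using \<open>\<eta> > 0\<close> by (simp add: add_nonneg_pos)
  show ?thesis
  proof (intro exI[of _ "min \<delta> (d / (norm w + \<eta>))"] conjI allI impI)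
    show "min \<delta> (d / (norm w + \<eta>)) > 0" using \<delta> d pos by simp
    fix h assume h: "0 < h \<and> h < min \<delta> (d / (norm w + \<eta>))"
    then obtain p where p: "\<phi> p = 0" "norm (p - (z + h *\<^sub>R w)) \<le> \<eta> * h" using \<delta> by auto
    have "norm (p - z) \<le> norm (p - (z + h *\<^sub>R w)) + norm (h *\<^sub>R w)"
      using norm_triangle_ineq[of "p - (z + h *\<^sub>R w)" "h *\<^sub>R w"] by simp
    also have "\<dots> \<le> h * (norm w + \<eta>)" using p h by (simp add: algebra_simps)
    also have "\<dots> < d" using h pos by (simp add: field_simps)
    finally have "b p \<ge> 0" using d(2)[of p] by (auto simp: dist_norm)
    with p show "\<exists>p. \<phi> p = 0 \<and> b p \<ge> 0 \<and> norm (p - (z + h *\<^sub>R w)) \<le> \<eta> * h" by blast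
  qed
next
  case True
  have D: "linear D" using der has_derivative_linear by blast
  have B: "linear b'" using b(1) has_derivative_linear by blast
  obtain v\<^sub>0 where v0: "D v\<^sub>0 = 0" "b' v\<^sub>0 \<noteq> 0" using transversal[OF True] by blast
  \<comment> \<open>The sign turns the transversal vector to the side where \<open>b\<close>
    increases.\<close>
  define v where "v = sgn (b' v\<^sub>0) *\<^sub>R v\<^sub>0"
  have v: "D v = 0" "b' v > 0"
    using v0 D B by (auto simp: v_def linear_scale sgn_if)
  \<comment> \<open>Half of the tolerance \<open>\<eta>\<close> is spent on the tilt; the
    \<open>1\<close> keeps the denominator positive.\<close>
  define \<epsilon> where "\<epsilon> = \<eta> / (2 * (norm v + 1))"
  define w' where "w' = w + \<epsilon> *\<^sub>R v"
  define \<beta> where "\<beta> = \<epsilon> * b' v"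
  have nv: "norm v + 1 > 0" by (simp add: add_nonneg_pos)
  have \<epsilon>: "\<epsilon> > 0" "\<epsilon> * norm v \<le> \<eta> / 2" using \<open>\<eta> > 0\<close> nv by (auto simp: \<epsilon>_def field_simps)
  have \<beta>: "\<beta> > 0" "b' w' \<ge> \<beta>"
    using \<epsilon> v inward[OF True] B by (auto simp: \<beta>_def w'_def linear_add linear_scale)
  obtain K where K: "K > 0" "\<And>c. norm (b' c) \<le> K * norm c"
    using linear_bounded_pos[OF B] by auto
  \<comment> \<open>The other half of \<open>\<eta>\<close> pays for the correction back to the zero
    set, whose effect through \<open>b'\<close> is also held to half of the growth rate
    \<open>\<beta>\<close>. The accuracy \<open>e\<close> chosen next spends the remaining half of
    \<open>\<beta>\<close> on the remainder of \<open>b\<close>.\<close>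
  define \<eta>' where "\<eta>' = min (\<eta> / 2) (\<beta> / (2 * K))"
  have \<eta>': "\<eta>' > 0" "\<eta>' \<le> \<eta> / 2" "K * \<eta>' \<le> \<beta> / 2"
    using \<open>\<eta> > 0\<close> \<beta> K(1) by (auto simp: \<eta>'_def min_def field_simps)
  define e where "e = \<beta> / 2 / (norm w' + \<eta>')"
  have pos: "norm w' + \<eta>' > 0" using \<eta>' by (simp add: add_nonneg_pos)
  then have e: "e > 0" "e * (norm w' + \<eta>') = \<beta> / 2"
    using \<beta> nonzero_eq_divide_eq[of "norm w' + \<eta>'" e "\<beta> / 2"] by (auto simp: e_def)
  obtain d where d: "d > 0"
    and dd: "\<And>y. norm (y - z) < d \<Longrightarrow> norm (b y - b z - b' (y - z)) \<le> e * norm (y - z)"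
    using b(1) e unfolding has_derivative_at_alt by blast
  have w': "D w' = 0" using D w v by (simp add: w'_def linear_add linear_scale)
  obtain \<delta> where \<delta>: "\<delta> > 0"
    "\<And>h. 0 < h \<Longrightarrow> h < \<delta> \<Longrightarrow> \<exists>p. \<phi> p = 0 \<and> norm (p - (z + h *\<^sub>R w')) \<le> \<eta>' * h"
    using zero_set_subtangential[OF cont der z R w' \<eta>'(1)] by blast
  show ?thesis
  proof (intro exI[of _ "min \<delta> (d / (norm w' + \<eta>'))"] conjI allI impI)
    show "min \<delta> (d / (norm w' + \<eta>')) > 0" using \<delta> d pos by simp
    fix h assume h: "0 < h \<and> h < min \<delta> (d / (norm w' + \<eta>'))"
    then obtain p where p: "\<phi> p = 0" "norm (p - (z + h *\<^sub>R w')) \<le> \<eta>' * h" using \<delta> by auto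
    have "norm (p - z) \<le> norm (p - (z + h *\<^sub>R w')) + norm (h *\<^sub>R w')"
      using norm_triangle_ineq[of "p - (z + h *\<^sub>R w')" "h *\<^sub>R w'"] by simp
    also have "\<dots> \<le> h * (norm w' + \<eta>')" using p h by (simp add: algebra_simps)
    finally have pz: "norm (p - z) \<le> h * (norm w' + \<eta>')" .
    also have "\<dots> < d" using h pos by (simp add: field_simps)
    finally have pd: "norm (p - z) < d" .
    have "e * norm (p - z) \<le> e * (h * (norm w' + \<eta>'))" using pz e by simp
    also have "\<dots> = h * (e * (norm w' + \<eta>'))" by (simp only: ac_simps)
    also have "\<dots> = h * (\<beta> / 2)" by (simp only: e(2))
    finally have 1: "b p \<ge> b' (p - z) - h * (\<beta> / 2)"
      using dd[OF pd] True by (auto simp: abs_le_iff)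
    have "b' (p - z) = b' (p - (z + h *\<^sub>R w')) + h * b' w'"
      using B by (simp add: linear_diff linear_add linear_scale algebra_simps)
    moreover have "h * b' w' \<ge> h * \<beta>" using h \<beta> by simp
    moreover have "\<bar>b' (p - (z + h *\<^sub>R w'))\<bar> \<le> h * (\<beta> / 2)"
    proof -
      have "\<bar>b' (p - (z + h *\<^sub>R w'))\<bar> \<le> K * (\<eta>' * h)"
        using K(2)[of "p - (z + h *\<^sub>R w')"] p(2) K(1) by (smt (verit) mult_left_mono real_norm_def)
      also have "\<dots> = h * (K * \<eta>')" by simp
      also have "\<dots> \<le> h * (\<beta> / 2)" using \<eta>'(3) h by (intro mult_left_mono) auto
      finally show ?thesis .
    qed
    ultimately have "b p \<ge> 0" using 1 by (auto simp: abs_le_iff)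
    moreover have "norm (p - (z + h *\<^sub>R w)) \<le> \<eta> * h"
    proof -
      have "norm (p - (z + h *\<^sub>R w)) \<le> norm (p - (z + h *\<^sub>R w')) + norm (h *\<^sub>R \<epsilon> *\<^sub>R v)"
        using norm_triangle_ineq[of "p - (z + h *\<^sub>R w')" "h *\<^sub>R \<epsilon> *\<^sub>R v"]
        by (simp add: w'_def algebra_simps)
      also have "norm (h *\<^sub>R \<epsilon> *\<^sub>R v) = h * (\<epsilon> * norm v)" using h \<epsilon> by simp
      also have "norm (p - (z + h *\<^sub>R w')) + h * (\<epsilon> * norm v) \<le> h * (\<eta> / 2) + h * (\<eta> / 2)"
      proof (rule add_mono)
        have "\<eta>' * h \<le> \<eta> / 2 * h" using h \<eta>' by (intro mult_right_mono) auto
        then show "norm (p - (z + h *\<^sub>R w')) \<le> h * (\<eta> / 2)" using p(2) by (simp add: mult.commute)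
        show "h * (\<epsilon> * norm v) \<le> h * (\<eta> / 2)" using h \<epsilon> by (intro mult_left_mono) auto
      qed
      finally show ?thesis by (simp add: mult.commute)
    qed
    ultimately show "\<exists>p. \<phi> p = 0 \<and> b p \<ge> 0 \<and> norm (p - (z + h *\<^sub>R w)) \<le> \<eta> * h"
      using p by blast
  qed
qed

section \<open>Flow invariance of closed sets\<close>

text \<open>Nagumo's theorem: at a nearest point \<open>z\<close> of \<open>S\<close> to \<open>x t\<close> the field is subtangential, so the
  distance to \<open>S\<close> satisfies \<open>d' \<le> L d\<close> for the upper right Dini derivative.\<close>

lemma subtangential_invariant:
  fixes F :: "'x::euclidean_space \<Rightarrow> 'x"
  assumes S: "closed S" "S \<subseteq> M" and a: "x a \<in> S"
    and lip: "L-lipschitz_on (ball (x a) (2 * r) \<inter> M) F"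
    and near: "\<And>t. t \<in> {a..b} \<Longrightarrow> x t \<in> ball (x a) r \<inter> M"
    and sol: "\<And>t. t \<in> {a..b} \<Longrightarrow> (x has_vector_derivative F (x t)) (at t within {a..b})"
    and sub: "\<And>z \<eta>. z \<in> S \<Longrightarrow> \<eta> > 0 \<Longrightarrow>
      \<exists>\<delta>>0. \<forall>h. 0 < h \<and> h < \<delta> \<longrightarrow> (\<exists>p\<in>S. norm (p - (z + h *\<^sub>R F z)) \<le> \<eta> * h)"
    and t: "t \<in> {a..b}"
  shows "x t \<in> S"
proof -
  define d where "d = (\<lambda>t. infdist (x t) S)"
  have ne: "S \<noteq> {}" using a by auto
  have L: "L \<ge> 0" using lip by (rule lipschitz_on_nonneg)
  have contx: "continuous_on {a..b} x"
    using sol has_vector_derivative_continuous continuous_on_eq_continuous_within by blast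
  then have contd: "continuous_on {a..b} d"
    unfolding d_def by (intro continuous_intros) auto
  have dini: "\<exists>\<delta>>0. \<forall>s. t < s \<and> s < t + \<delta> \<and> s \<le> b \<longrightarrow> d s \<le> d t + (s - t) * (L * d t + \<eta>)"
    if t: "a \<le> t" "t < b" and "\<eta> > 0" for t \<eta>
  proof -
    obtain z where z: "z \<in> S" "dist (x t) z = d t"
      using infdist_attains_inf[OF S(1) ne] unfolding d_def by metis
    have xt: "dist (x a) (x t) < r" "x t \<in> M" using near[of t] t by auto
    \<comment> \<open>The nearest point \<open>z\<close> may lie outside the ball of radius
      \<open>r\<close>, but since \<open>x a\<close> is in \<open>S\<close> it is within
      \<open>2 * r\<close> of \<open>x a\<close>. Hence the Lipschitz bound on the doubled
      ball.\<close>
    have "d t \<le> dist (x t) (x a)" unfolding d_def using a by (rule infdist_le)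
    then have "dist (x a) z < 2 * r"
      using dist_triangle[of "x a" z "x t"] xt z(2) by (simp add: dist_commute)
    moreover have "dist (x a) (x t) < 2 * r" using xt zero_le_dist[of "x a" "x t"] by linarith
    ultimately have "dist (F (x t)) (F z) \<le> L * dist (x t) z"
      using lipschitz_onD[OF lip, of "x t" z] z S xt by auto
    then have Fz: "norm (F (x t) - F z) \<le> L * d t" using z by (simp add: dist_norm)
    obtain \<delta>1 where \<delta>1: "\<delta>1 > 0"
      "\<And>h. 0 < h \<Longrightarrow> h < \<delta>1 \<Longrightarrow> \<exists>p\<in>S. norm (p - (z + h *\<^sub>R F z)) \<le> \<eta> / 2 * h"
      using sub[OF z(1), of "\<eta> / 2"] \<open>\<eta> > 0\<close> by auto
    have "(x has_derivative (\<lambda>h. h *\<^sub>R F (x t))) (at t within {a..b})"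
      using sol[of t] t by (simp add: has_vector_derivative_def)
    then obtain \<delta>2 where \<delta>2: "\<delta>2 > 0"
      "\<And>s. s \<in> {a..b} \<Longrightarrow> norm (s - t) < \<delta>2 \<Longrightarrow>
         norm (x s - x t - (s - t) *\<^sub>R F (x t)) \<le> \<eta> / 2 * norm (s - t)"
      using \<open>\<eta> > 0\<close> unfolding has_derivative_within_alt by (metis half_gt_zero)
    show ?thesis
    proof (intro exI[of _ "min \<delta>1 \<delta>2"] conjI allI impI)
      show "min \<delta>1 \<delta>2 > 0" using \<delta>1 \<delta>2 by simp
      fix s assume s: "t < s \<and> s < t + min \<delta>1 \<delta>2 \<and> s \<le> b"
      define h where "h = s - t"
      have h: "h > 0" "h < \<delta>1" "h < \<delta>2" using s by (auto simp: h_def)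
      obtain p where p: "p \<in> S" "norm (p - (z + h *\<^sub>R F z)) \<le> \<eta> / 2 * h" using \<delta>1 h by blast
      have xs: "norm (x s - x t - h *\<^sub>R F (x t)) \<le> \<eta> / 2 * h"
        using \<delta>2(2)[of s] h s t by (auto simp: h_def)
      \<comment> \<open>The contributions are the first-order error of the trajectory, the current
        displacement, the variation of the field between \<open>x t\<close> and \<open>z\<close>,
        and the subtangential error at \<open>z\<close>; each of the two errors is at most
        \<open>\<eta> / 2 * h\<close>.\<close>
      have "x s - p = (x s - x t - h *\<^sub>R F (x t)) + (x t - z) + h *\<^sub>R (F (x t) - F z)
          - (p - (z + h *\<^sub>R F z))"
        by (simp add: algebra_simps)
      then have "norm (x s - p) \<le> norm (x s - x t - h *\<^sub>R F (x t)) + norm (x t - z)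
          + norm (h *\<^sub>R (F (x t) - F z)) + norm (p - (z + h *\<^sub>R F z))"
        by (smt (verit) norm_triangle_ineq norm_triangle_ineq4)
      moreover have "norm (h *\<^sub>R (F (x t) - F z)) \<le> h * (L * d t)" using Fz h by simp
      moreover have "norm (x t - z) = d t" using z by (simp add: dist_norm)
      ultimately have "norm (x s - p) \<le> d t + h * (L * d t + \<eta>)"
        using xs p by (simp add: algebra_simps)
      moreover have "d s \<le> dist (x s) p" unfolding d_def using p(1) by (rule infdist_le)
      ultimately show "d s \<le> d t + (s - t) * (L * d t + \<eta>)" by (simp add: dist_norm h_def)
    qed
  qed
  \<comment> \<open>The rate \<open>L + 1\<close> instead of \<open>L\<close> lets the exponential
    absorb the additive slack of the Dini estimate, because \<open>E t \<ge> 1\<close>.\<close>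
  define E where "E = (\<lambda>t. exp ((L + 1) * (t - a)))"
  have bound: "d t \<le> \<epsilon> * E t" if \<epsilon>: "\<epsilon> > 0" for \<epsilon>
  proof (rule right_extension_interval[where P = "\<lambda>t. d t \<le> \<epsilon> * E t", OF _ _ _ t])
    show "closed {t \<in> {a..b}. d t \<le> \<epsilon> * E t}"
      unfolding E_def
      by (intro continuous_on_closed_Collect_le contd continuous_intros closed_atLeastAtMost)
    show "d a \<le> \<epsilon> * E a" using a \<epsilon> by (simp add: d_def E_def)
    fix t assume t: "a \<le> t" "t < b" and dt: "d t \<le> \<epsilon> * E t"
    obtain \<delta> where \<delta>: "\<delta> > 0"
      "\<And>s. t < s \<Longrightarrow> s < t + \<delta> \<Longrightarrow> s \<le> b \<Longrightarrow> d s \<le> d t + (s - t) * (L * d t + \<epsilon>)"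
      using dini[OF t \<epsilon>] by blast
    have "d s \<le> \<epsilon> * E s" if s: "t < s" "s < t + \<delta>" "s \<le> b" for s
    proof -
      have "E t \<ge> 1" using t L by (simp add: E_def)
      then have "\<epsilon> \<le> \<epsilon> * E t" using \<open>\<epsilon> > 0\<close> by simp
      moreover have "L * d t \<le> L * (\<epsilon> * E t)" using dt L by (rule mult_left_mono)
      ultimately have "L * d t + \<epsilon> \<le> (L + 1) * (\<epsilon> * E t)" by (simp add: algebra_simps)
      then have "(s - t) * (L * d t + \<epsilon>) \<le> (s - t) * ((L + 1) * (\<epsilon> * E t))"
        using s by (intro mult_left_mono) auto
      with \<delta>(2)[OF s] dt have "d s \<le> \<epsilon> * E t * (1 + (L + 1) * (s - t))"
        by (simp add: algebra_simps)
      also have "\<dots> \<le> \<epsilon> * E t * exp ((L + 1) * (s - t))"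
        using \<open>\<epsilon> > 0\<close> by (intro mult_left_mono exp_ge_add_one_self) (auto simp: E_def)
      also have "\<dots> = \<epsilon> * E s"
        by (simp add: E_def mult.assoc exp_add[symmetric] algebra_simps)
      finally show ?thesis .
    qed
    with \<delta>(1) show "\<exists>\<delta>>0. \<forall>s. t < s \<and> s < t + \<delta> \<and> s \<le> b \<longrightarrow> d s \<le> \<epsilon> * E s" by blast
  qed
  have "E t > 0" by (simp add: E_def)
  have "d t \<le> 0"
  proof (rule field_le_epsilon)
    fix e :: real assume "e > 0"
    then show "d t \<le> 0 + e" using bound[of "e / E t"] \<open>E t > 0\<close> by simp
  qed
  then have "infdist (x t) S = 0" using infdist_nonneg[of "x t" S] by (simp add: d_def)
  then show ?thesis using in_closed_iff_infdist_zero[OF S(1) ne] by blast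
qed

section \<open>Pseudoinverses and matrices of full row rank\<close>

text \<open>Multiplying \<open>A ** X ** A = A\<close> by \<open>R\<close> gives
  \<open>A ** X = mat 1\<close> for every pseudoinverse \<open>X\<close>. Then \<open>B ** A\<close>
  and \<open>C ** A\<close> are the same orthogonal projection, from which \<open>B\<close> and
  \<open>C\<close> are recovered.\<close>

lemma is_pinv_right_invertible_unique:
  fixes A :: "real^'n^'m"
  assumes R: "A ** R = mat 1" and B: "is_pinv A B" and C: "is_pinv A C"
  shows "A ** B = mat 1" "B = C"
proof -
  have right: "A ** X = mat 1" if "is_pinv A X" for X
  proof -
    have "A ** X = A ** X ** (A ** R)" by (simp add: R)
    also have "\<dots> = (A ** X ** A) ** R" by (simp add: matrix_mul_assoc)
    also have "\<dots> = mat 1" using that R by (simp add: is_pinv_def)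
    finally show ?thesis .
  qed
  show AB: "A ** B = mat 1" using right B .
  have AC: "A ** C = mat 1" using right C .
  \<comment> \<open>Transposing reverses the two symmetric factors, and the reversed product
    collapses to \<open>C ** A\<close>.\<close>
  have "B ** A = (B ** (A ** C)) ** A" by (simp add: AC)
  also have "\<dots> = (B ** A) ** (C ** A)" by (simp add: matrix_mul_assoc)
  finally have "transpose (B ** A) = transpose (C ** A) ** transpose (B ** A)"
    by (metis matrix_transpose_mul)
  then have "B ** A = (C ** A) ** (B ** A)" using B C by (simp add: is_pinv_def)
  also have "\<dots> = (C ** (A ** B)) ** A" by (simp add: matrix_mul_assoc)
  also have "\<dots> = C ** A" by (simp add: AB)
  finally have BA: "B ** A = C ** A" .
  have "B = (B ** A) ** B" using B by (simp add: is_pinv_def)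
  also have "\<dots> = C ** (A ** B)" by (simp add: BA matrix_mul_assoc)
  finally show "B = C" by (simp add: AB)
qed

lemma full_row_rank_iff_right_invertible:
  "full_row_rank (A :: real^'n^'m) \<longleftrightarrow> (\<exists>R. A ** R = mat 1)"
  unfolding full_row_rank_def full_rank_surjective matrix_right_invertible_surjective ..

text \<open>The pseudoinverse has the closed form \<open>transpose A ** H\<close>, with
  \<open>H\<close> the inverse of the Gram matrix \<open>A ** transpose A\<close>. Exhibiting it
  settles the existence required by the definite description in \<open>pinv\<close>.\<close>

lemma full_row_rank_mult_pinv:
  fixes A :: "real^'n^'m"
  assumes "full_row_rank A"
  shows "A ** pinv A = mat 1"
proof -
  obtain R where R: "A ** R = mat 1"
    using assms by (auto simp: full_row_rank_iff_right_invertible)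
  define G where "G = A ** transpose A"
  \<comment> \<open>\<open>G\<close> and \<open>transpose A\<close> have the same kernel, which is
    trivial because \<open>transpose R\<close> is a left inverse of
    \<open>transpose A\<close>.\<close>
  have "y = 0" if "G *v y = 0" for y
  proof -
    have "norm (transpose A *v y) ^ 2 = (G *v y) \<bullet> y"
      by (simp add: G_def power2_norm_eq_inner dot_lmul_matrix[symmetric] matrix_vector_mul_assoc[symmetric] inner_commute)
    then have "transpose A *v y = 0" using that by simp
    then have "transpose R *v (transpose A *v y) = 0" by simp
    then show "y = 0"
      by (simp add: vector_matrix_mul_assoc R)
  qed
  then obtain H where H: "H ** G = mat 1"
    using matrix_left_invertible_ker by blast
  then have GH: "G ** H = mat 1" using matrix_left_right_inverse by blast
  have "transpose G = G" by (simp add: G_def matrix_transpose_mul)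
  then have "transpose H ** G = mat 1" by (metis GH matrix_transpose_mul transpose_mat)
  then have TH: "transpose H = H" by (metis GH matrix_mul_assoc matrix_mul_lid matrix_mul_rid)
  have AB: "A ** (transpose A ** H) = mat 1" using GH by (simp add: G_def matrix_mul_assoc)
  have "is_pinv A (transpose A ** H)"
    unfolding is_pinv_def
  proof (intro conjI)
    show "A ** (transpose A ** H) ** A = A" by (simp add: AB)
    show "transpose A ** H ** A ** (transpose A ** H) = transpose A ** H"
      by (metis AB matrix_mul_assoc matrix_mul_rid)
    show "transpose (A ** (transpose A ** H)) = A ** (transpose A ** H)" by (simp add: AB)
    show "transpose (transpose A ** H ** A) = transpose A ** H ** A"
      by (simp add: matrix_transpose_mul TH matrix_mul_assoc)
  qed
  then have "is_pinv A (pinv A)"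
    unfolding pinv_def using is_pinv_right_invertible_unique(2)[OF R] by (metis theI)
  then show ?thesis using is_pinv_right_invertible_unique(1)[OF R] by blast
qed

text \<open>With \<open>R\<close> a right inverse at \<open>x\<close>, \<open>det (A y ** R)\<close>
  is continuous in \<open>y\<close> and equals 1 at \<open>x\<close>; where it is nonzero,
  \<open>A y\<close> is right invertible.\<close>

lemma open_full_row_rank:
  fixes A :: "'x::t2_space \<Rightarrow> real^'n^'m"
  assumes cont: "continuous_on UNIV A" and x: "full_row_rank (A x)"
  shows "\<exists>U. open U \<and> x \<in> U \<and> (\<forall>y\<in>U. full_row_rank (A y))"
proof -
  obtain R where R: "A x ** R = mat 1"
    using x by (auto simp: full_row_rank_iff_right_invertible)
  have "continuous_on UNIV (\<lambda>y. det (A y ** R))"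
    unfolding det_def matrix_matrix_mult_def
    by (auto intro!: continuous_intros cont)
  then have "open {y. det (A y ** R) \<noteq> 0}"
    by (intro open_Collect_neq) auto
  moreover have "full_row_rank (A y)" if "det (A y ** R) \<noteq> 0" for y
    using that unfolding full_row_rank_iff_right_invertible
    by (metis invertible_def invertible_det_nz matrix_mul_assoc)
  ultimately show ?thesis
    using R by (intro exI[of _ "{y. det (A y ** R) \<noteq> 0}"]) auto
qed

section \<open>Derivatives, partial Jacobians and gradients\<close>

lemma Ck_1D:
  assumes "Ck 1 f"
  shows "(f has_derivative frechet_derivative f (at x)) (at x)"
    "continuous_on UNIV (\<lambda>x. frechet_derivative f (at x) v)"
    "continuous_on UNIV f"
proof -
  have dif: "\<And>x. f differentiable (at x)" and c: "\<And>v. continuous_on UNIV (\<lambda>x. frechet_derivative f (at x) v)"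
    using assms by auto
  show "(f has_derivative frechet_derivative f (at x)) (at x)"
    using dif frechet_derivative_works by blast
  show "continuous_on UNIV (\<lambda>x. frechet_derivative f (at x) v)" by (rule c)
  show "continuous_on UNIV f"
    using dif by (simp add: continuous_on_eq_continuous_at differentiable_imp_continuous_within)
qed

text \<open>Chain rule along the two coordinate embeddings. It identifies the kernel of the total
  derivative with the tangency condition in \<open>regular_boundary\<close>.\<close>

lemma partial_jacobians:
  fixes \<phi> :: "('d::finite, 'a::finite) state \<Rightarrow> real^'m"
  assumes "(\<phi> has_derivative D) (at x)"
  shows "D (v, 0) = Jd \<phi> x *v v" "D (0, w) = Ja \<phi> x *v w" "D y = Jd \<phi> x *v fst y + Ja \<phi> x *v snd y"
proof -
  have D: "linear D" using assms has_derivative_linear by blast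
  have 1: "((\<lambda>y. \<phi> (y, snd x)) has_derivative (\<lambda>v. D (v, 0))) (at (fst x))"
    by (rule has_derivative_compose[of "\<lambda>y. (y, snd x)" "\<lambda>v. (v, 0)" _ _ \<phi> D])
       (use assms in \<open>auto intro!: derivative_eq_intros\<close>)
  have 2: "((\<lambda>y. \<phi> (fst x, y)) has_derivative (\<lambda>v. D (0, v))) (at (snd x))"
    by (rule has_derivative_compose[of "\<lambda>y. (fst x, y)" "\<lambda>v. (0, v)" _ _ \<phi> D])
       (use assms in \<open>auto intro!: derivative_eq_intros\<close>)
  show d: "D (v, 0) = Jd \<phi> x *v v" for v
    unfolding Jd_def jacobian_def frechet_derivative_at[OF 1, symmetric]
    using has_derivative_linear[OF 1] by (simp add: matrix_works)
  show a: "D (0, w) = Ja \<phi> x *v w" for w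
    unfolding Ja_def jacobian_def frechet_derivative_at[OF 2, symmetric]
    using has_derivative_linear[OF 2] by (simp add: matrix_works)
  have "D y = D ((fst y, 0) + (0, snd y))" by simp
  also have "\<dots> = D (fst y, 0) + D (0, snd y)" using D by (rule linear_add)
  finally show "D y = Jd \<phi> x *v fst y + Ja \<phi> x *v snd y" by (simp add: d a)
qed

lemma continuous_on_Ja:
  fixes \<phi> :: "('d::finite, 'a::finite) state \<Rightarrow> real^'m"
  assumes "Ck 1 \<phi>"
  shows "continuous_on UNIV (Ja \<phi>)"
proof -
  have "Ja \<phi> x $ i $ j = frechet_derivative \<phi> (at x) (0, axis j 1) $ i" for x i j
    by (simp add: partial_jacobians(2)[OF Ck_1D(1)[OF assms]] matrix_vector_mul_component inner_axis)
  then have "Ja \<phi> = (\<lambda>x. \<chi> i j. frechet_derivative \<phi> (at x) (0, axis j 1) $ i)"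
    by (simp add: fun_eq_iff vec_eq_iff)
  then show ?thesis by (auto intro!: continuous_intros Ck_1D(2)[OF assms])
qed

lemma grad_inner:
  assumes "(b has_derivative D) (at x)"
  shows "grad b x \<bullet> v = D v"
proof -
  have "D v = D (\<Sum>i\<in>Basis. (v \<bullet> i) *\<^sub>R i)" by (simp add: euclidean_representation)
  also have "\<dots> = (\<Sum>i\<in>Basis. (v \<bullet> i) * D i)"
    using has_derivative_linear[OF assms] by (simp add: linear_sum linear_scale)
  finally show ?thesis
    unfolding grad_def frechet_derivative_at[OF assms, symmetric]
    by (simp add: inner_sum_left inner_commute[of v] mult.commute)
qed

section \<open>Constraint and barrier along the closed loop\<close>

text \<open>Turns the barrier inequality into a bound on the derivative of \<open>b\<close> in the
  direction of the closed loop.\<close>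

lemma lie_closed_loop:
  "lie_f (fhat \<phi> fd) b x + lie_g (ghat \<phi> gd) b x \<bullet> \<mu> x = grad b x \<bullet> closed_loop \<phi> fd gd \<mu> x"
  by (simp add: lie_f_def lie_g_def closed_loop_def block_mv_def inner_prod_def inner_add_left
      inner_add_right dot_lmul_matrix)

text \<open>Full row rank gives \<open>Ja \<phi> x ** pinv (Ja \<phi> x) = mat 1\<close>, so the
  lower block of the field cancels what the upper block contributes to the derivative of
  \<open>\<phi>\<close>.\<close>

lemma closed_loop_tangent:
  assumes "full_row_rank (Ja \<phi> x)"
  shows "Jd \<phi> x *v fst (closed_loop \<phi> fd gd \<mu> x) + Ja \<phi> x *v snd (closed_loop \<phi> fd gd \<mu> x) = 0"
proof -
  let ?J = "Ja \<phi> x" and ?f = "fd x + gd x *v \<mu> x"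
  have "snd (closed_loop \<phi> fd gd \<mu> x) = - (pinv ?J *v (Jd \<phi> x *v ?f))"
    by (simp add: closed_loop_def fhat_def ghat_def block_mv_def matrix_vector_mul_assoc[symmetric]
        matrix_vector_right_distrib vec.neg scaleR_matrix_vector_assoc[of "-1", simplified, symmetric])
  moreover have "fst (closed_loop \<phi> fd gd \<mu> x) = ?f"
    by (simp add: closed_loop_def fhat_def ghat_def block_mv_def)
  moreover have "?J *v (pinv ?J *v y) = y" for y
    by (simp add: matrix_vector_mul_assoc full_row_rank_mult_pinv[OF assms])
  ultimately show ?thesis
    by (simp add: vec.neg del: matrix_vector_mul_assoc)
qed

text \<open>The derivative of \<open>\<phi>\<close> along the trajectory vanishes. The rank is
  assumed along the trajectory because index one provides it only on the safe part of the manifold;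
  openness extends it for short times.\<close>

lemma solution_stays_on_manifold:
  fixes \<phi> :: "('d::finite, 'a::finite) state \<Rightarrow> real^'m"
  assumes \<phi>: "Ck 1 \<phi>" and a: "\<phi> (x a) = 0" and t: "t \<in> {a..b}"
    and sol: "\<And>t. t \<in> {a..b} \<Longrightarrow>
      (x has_vector_derivative closed_loop \<phi> fd gd \<mu> (x t)) (at t within {a..b})"
    and rank: "\<And>t. t \<in> {a..b} \<Longrightarrow> full_row_rank (Ja \<phi> (x t))"
  shows "\<phi> (x t) = 0"
proof -
  have "((\<lambda>t. \<phi> (x t)) has_derivative (\<lambda>_. 0)) (at t within {a..b})" if t: "t \<in> {a..b}" for t
  proof -
    let ?D = "frechet_derivative \<phi> (at (x t))" and ?F = "closed_loop \<phi> fd gd \<mu> (x t)"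
    have D: "(\<phi> has_derivative ?D) (at (x t))" by (rule Ck_1D(1)[OF \<phi>])
    have "((\<lambda>t. \<phi> (x t)) has_derivative (\<lambda>h. ?D (h *\<^sub>R ?F))) (at t within {a..b})"
      using has_derivative_compose[OF sol[OF t, unfolded has_vector_derivative_def] D] .
    moreover have "?D ?F = 0"
      using closed_loop_tangent[OF rank[OF t]] by (simp only: partial_jacobians(3)[OF D])
    ultimately show ?thesis using has_derivative_linear[OF D] by (simp add: linear_scale)
  qed
  then obtain c where "\<And>t. t \<in> {a..b} \<Longrightarrow> \<phi> (x t) = c"
    using has_derivative_zero_constant[of "{a..b}" "\<lambda>t. \<phi> (x t)"] by auto
  with a t show ?thesis by (metis atLeastAtMost_iff order.trans order_refl)
qed

section \<open>Positive invariance under the barrier condition\<close>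

theorem theorem4:
  fixes fd :: "('d::finite, 'a::finite) state \<Rightarrow> real^'d"
    and gd :: "('d, 'a) state \<Rightarrow> real^'u^'d"
    and \<phi> :: "('d, 'a) state \<Rightarrow> real^'m"
    and h b :: "('d, 'a) state \<Rightarrow> real"
    and \<alpha>\<^sub>0 :: "real \<Rightarrow> real"
    and \<mu> :: "('d, 'a) state \<Rightarrow> real^'u"
  assumes smooth: "smooth fd" "smooth gd" "smooth \<phi>"
    and closed_safe: "closed (superlevel h)"
    and index: "index_one \<phi> (superlevel h)"
    and Jext_rank: "\<forall>x \<in> superlevel h \<inter> constraint_manifold \<phi>. full_row_rank (Jext \<phi> gd x)"
    and alpha: "class_Kinf \<alpha>\<^sub>0"
    and cbf: "is_CBF h b"
    and lipschitz: "locally_Lipschitz_along (constraint_manifold \<phi>) (closed_loop \<phi> fd gd \<mu>)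
                      (superlevel h \<inter> constraint_manifold \<phi>)"
    and regular: "regular_boundary \<phi> b"
    and constraint_input: "\<forall>x \<in> superlevel b \<inter> constraint_manifold \<phi>.
           Proj \<phi> x *v (Jd \<phi> x *v fd x + (Jd \<phi> x ** gd x) *v \<mu> x) = 0"
    and barrier_input: "\<forall>x \<in> superlevel b \<inter> constraint_manifold \<phi>.
           lie_f (fhat \<phi> fd) b x + lie_g (ghat \<phi> gd) b x \<bullet> \<mu> x \<ge> - \<alpha>\<^sub>0 (b x)"
  shows "positively_invariant (closed_loop \<phi> fd gd \<mu>) (superlevel b \<inter> constraint_manifold \<phi>)"
proof -
  define F where "F = closed_loop \<phi> fd gd \<mu>"
  define M where "M = constraint_manifold \<phi>"
  define S where "S = superlevel b \<inter> M"
  have \<phi>: "Ck 1 \<phi>" using smooth(3) smooth_def by blast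
  have b: "Ck 1 b" and bh: "superlevel b \<subseteq> superlevel h" using cbf by (auto simp: is_CBF_def)
  have Seq: "S = {x. b x \<ge> 0 \<and> \<phi> x = 0}"
    by (auto simp: S_def M_def superlevel_def constraint_manifold_def)
  have closedS: "closed S"
    unfolding Seq using Ck_1D(3)[OF \<phi>] Ck_1D(3)[OF b]
    by (intro closed_Collect_conj closed_Collect_le closed_Collect_eq continuous_intros)
  have rank: "full_row_rank (Ja \<phi> z)" if "z \<in> S" for z
    using that index bh by (auto simp: S_def M_def index_one_def)
  have sub: "\<exists>\<delta>>0. \<forall>k. 0 < k \<and> k < \<delta> \<longrightarrow> (\<exists>p\<in>S. norm (p - (z + k *\<^sub>R F z)) \<le> \<eta> * k)"
    if z: "z \<in> S" and "\<eta> > 0" for z \<eta>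
  proof -
    let ?D = "frechet_derivative \<phi> (at z)" and ?b = "frechet_derivative b (at z)"
    \<comment> \<open>The correction moves the algebraic coordinates only; \<open>Ja\<close> times
      its pseudoinverse being the identity makes \<open>?R\<close> a right inverse of
      \<open>?D\<close>.\<close>
    let ?R = "\<lambda>c. (0, pinv (Ja \<phi> z) *v c) :: ('d, 'a) state"
    have D: "(\<phi> has_derivative ?D) (at z)" by (rule Ck_1D(1)[OF \<phi>])
    have B: "(b has_derivative ?b) (at z)" by (rule Ck_1D(1)[OF b])
    have "\<exists>\<delta>>0. \<forall>k. 0 < k \<and> k < \<delta> \<longrightarrow>
      (\<exists>p. \<phi> p = 0 \<and> b p \<ge> 0 \<and> norm (p - (z + k *\<^sub>R F z)) \<le> \<eta> * k)"
    proof (rule constrained_superlevel_subtangential[where R = ?R, OF Ck_1D(3)[OF \<phi>] D _ _ _ _ B])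
      show "\<phi> z = 0" "b z \<ge> 0" using z by (auto simp: Seq)
      show "linear ?R"
        by (auto intro!: linearI simp: matrix_vector_right_distrib matrix_vector_mult_scaleR)
      show "?D (?R c) = c" for c
        by (simp add: partial_jacobians(2)[OF D] matrix_vector_mul_assoc
            full_row_rank_mult_pinv rank z)
      show "?D (F z) = 0"
        using closed_loop_tangent[OF rank[OF z]]
        by (simp only: F_def partial_jacobians(3)[OF D])
      \<comment> \<open>At \<open>b z = 0\<close> the right side of the barrier inequality is
        \<open>- \<alpha>\<^sub>0 0 = 0\<close>.\<close>
      show "?b (F z) \<ge> 0" if "b z = 0"
        using bspec[OF barrier_input, of z] z that alpha
        by (simp add: lie_closed_loop grad_inner[OF B] class_Kinf_def F_def S_def M_def)
      show "\<exists>v. ?D v = 0 \<and> ?b v \<noteq> 0" if "b z = 0"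
      proof -
        have "\<exists>v. Jd \<phi> z *v fst v + Ja \<phi> z *v snd v = 0 \<and> grad b z \<bullet> v \<noteq> 0"
          using regular z that unfolding regular_boundary_def S_def M_def by blast
        then show ?thesis by (simp only: grad_inner[OF B] partial_jacobians(3)[OF D])
      qed
    qed fact
    then show ?thesis unfolding Seq by blast
  qed
  have "x T \<in> S"
    if I: "is_interval I" "0 \<in> I" "I \<subseteq> {0..}" and sol: "solution_on F I x" and x0: "x 0 \<in> S"
      and T: "T \<in> I" for I x T
  proof -
    have sub_I: "{0..T} \<subseteq> I" using I T by (meson atLeastAtMost_iff mem_is_interval_1_I subsetI)
    have T0: "T \<ge> 0" using I T by auto
    have der: "(x has_vector_derivative F (x t)) (at t within J)" if "J \<subseteq> {0..T}" "t \<in> J" for t J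
      using sol that sub_I
      by (meson has_vector_derivative_within_subset solution_on_def subsetD subset_trans)
    have contx: "continuous_on {0..T} x"
      using der[of "{0..T}"] has_vector_derivative_continuous continuous_on_eq_continuous_within
      by blast
    show ?thesis
    proof (rule right_extension_interval[where P = "\<lambda>t. x t \<in> S" and a = 0 and b = T])
      have "{t \<in> {0..T}. x t \<in> S} = {0..T} \<inter> x -` S" by auto
      then show "closed {t \<in> {0..T}. x t \<in> S}"
        using continuous_closed_preimage[OF contx closed_atLeastAtMost closedS] by (simp only:)
      fix a assume a: "0 \<le> a" "a < T" "x a \<in> S"
      then have "x a \<in> superlevel h \<inter> M" using bh by (auto simp: S_def)
      then obtain \<epsilon> L where \<epsilon>: "\<epsilon> > 0" and lip: "L-lipschitz_on (ball (x a) \<epsilon> \<inter> M) F"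
        using lipschitz unfolding locally_Lipschitz_along_def F_def M_def by blast
      obtain U where U: "open U" "x a \<in> U" "\<And>y. y \<in> U \<Longrightarrow> full_row_rank (Ja \<phi> y)"
        using open_full_row_rank[OF continuous_on_Ja[OF \<phi>] rank[OF a(3)]] by blast
      \<comment> \<open>The radius is halved to fit the doubled ball in
        \<open>subtangential_invariant\<close>; \<open>U\<close> keeps the rank full along the short
        piece of trajectory.\<close>
      have "open (U \<inter> ball (x a) (\<epsilon> / 2))" "x a \<in> U \<inter> ball (x a) (\<epsilon> / 2)" using U \<epsilon> by auto
      then obtain r where r: "r > 0" "ball (x a) r \<subseteq> U \<inter> ball (x a) (\<epsilon> / 2)"
        using openE by blast
      obtain \<delta> where \<delta>: "\<delta> > 0" "\<And>s. s \<in> {0..T} \<Longrightarrow> dist s a < \<delta> \<Longrightarrow> dist (x s) (x a) < r"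
        using contx a r(1) unfolding continuous_on_iff by (metis atLeastAtMost_iff less_imp_le)
      have "x s \<in> S" if s: "a < s" "s < a + \<delta>" "s \<le> T" for s
      proof -
        have near: "x t \<in> U \<inter> ball (x a) (\<epsilon> / 2)" if "t \<in> {a..s}" for t
        proof -
          have "dist (x t) (x a) < r" using \<delta>(2)[of t] that s a by (auto simp: dist_real_def)
          then show ?thesis using r(2) by (metis dist_commute mem_ball subsetD)
        qed
        have der': "(x has_vector_derivative F (x t)) (at t within {a..s})" if "t \<in> {a..s}" for t
          using der[of "{a..s}" t] that s a by auto
        \<comment> \<open>Staying on \<open>M\<close> has to come first: the Lipschitz bound
          compares points of \<open>M\<close> only.\<close>
        have onM: "x t \<in> M" if "t \<in> {a..s}" for t
          using solution_stays_on_manifold[OF \<phi> _ that der'[unfolded F_def]] near U(3) a(3)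
          by (auto simp: Seq M_def constraint_manifold_def)
        show ?thesis
        proof (rule subtangential_invariant[where S = S and F = F and x = x and a = a and b = s
              and r = "\<epsilon> / 2" and M = M])
          show "L-lipschitz_on (ball (x a) (2 * (\<epsilon> / 2)) \<inter> M) F" using lip by simp
        qed (use closedS a near onM der' sub s in \<open>auto simp: S_def\<close>)
      qed
      with \<delta>(1) show "\<exists>\<delta>>0. \<forall>s. a < s \<and> s < a + \<delta> \<and> s \<le> T \<longrightarrow> x s \<in> S" by blast
    qed (use x0 T0 in auto)
  qed
  then have "positively_invariant F S"
    unfolding positively_invariant_def by (intro allI impI ballI)
  then show ?thesis by (simp only: F_def M_def S_def)
qed

end
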